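(* For every integer $n>1$, $$\zeta(n)=\lim_{z\to0^+}\frac{\prod_{j=0}^{n-1}\Gamma\left(1-z\,e(j/n)\right)-\prod_{j=0}^{n-1}\Gamma\left(1-z\,e(j/n)\right)^{-1}}{2z^n}.$$
   Context: $\zeta$ is the Riemann zeta function, $\Gamma$ is Euler's gamma function, and $e(x):=e^{2\pi i x}$. *)

theory Defs
  imports "HOL-Complex_Analysis.Complex_Analysis"
begin

text \<open>
  Where the Dirichlet series diverges, the value is that of the analytic continuation to
  the plane punctured at 1 (unique by the identity theorem). The value at the pole itself
  is a dummy.
\<close>

definition zeta_series :: "complex \<Rightarrow> complex" where
  "zeta_series s = (\<Sum>k. 1 / of_nat (Suc k) powr s)"

definition riemann_zeta :: "complex \<Rightarrow> complex" where
  "riemann_zeta s =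
     (if Re s > 1 then zeta_series s
      else if s = 1 then 0
      else (THE w. \<exists>f. f holomorphic_on (- {1}) \<and> (\<forall>t. Re t > 1 \<longrightarrow> f t = zeta_series t) \<and> w = f s))"

definition e :: "real \<Rightarrow> complex" where
  "e x = exp (2 * of_real pi * \<i> * of_real x)"

end

theory Submission
  imports Defs "HOL-Computational_Algebra.Fundamental_Theorem_Algebra"
begin

text \<open>
  The numbers \<open>\<omega>\<^sub>j = e (j / n)\<close> are the \<open>n\<close>-th roots of unity. In the product of the
  Weierstrass products of the functions \<open>1 / \<Gamma>(1 - z \<omega>\<^sub>j)\<close> all exponential factors cancel,
  because \<open>\<Sum>\<^sub>j \<omega>\<^sub>j = 0\<close> for \<open>n > 1\<close>, and the linear factors combine by
  \<open>\<Prod>\<^sub>j (1 - y \<omega>\<^sub>j) = 1 - y\<^sup>n\<close>. Hence, for \<open>z \<noteq> 0\<close>,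
  \<open>Q(z) = \<Prod>\<^sub>j 1 / \<Gamma>(1 - z \<omega>\<^sub>j) = \<Prod>\<^sub>k\<^sub>\<ge>\<^sub>1 (1 - z\<^sup>n / k\<^sup>n)\<close>
  (lemma \<open>rGamma_roots_prod_LIMSEQ\<close>).

  For \<open>0 < z \<le> 1\<close> every factor lies in \<open>[0, 1]\<close>, so with \<open>x = z\<^sup>n\<close> the elementary inequalities
  \<open>1 - \<Sum>a \<le> \<Prod>(1 - a)\<close> and \<open>\<Prod>(1 - a) * (1 + \<Sum>a) \<le> 1\<close> give
  \<open>\<zeta>(n) / (1 + x \<zeta>(n)) \<le> (1 - Q(z)) / x \<le> \<zeta>(n)\<close>.
  Thus \<open>(1 - Q) / x\<close> tends to \<open>\<zeta>(n)\<close> and \<open>Q\<close> tends to \<open>1\<close>, and the quotient in question is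
  \<open>(1 / Q - Q) / (2 x) = (1 - Q) / x * ((1 + Q) / (2 Q))\<close>.
\<close>

section \<open>Roots of unity\<close>

lemma bij_betw_e_roots_unity:
  assumes "n > 0"
  shows "bij_betw (\<lambda>j. e (real j / real n)) {0..n-1} {z. z ^ n = 1}"
proof -
  have "e (real j / real n) = cis (2 * pi * real j / real n)" for j
    by (simp add: e_def cis_conv_exp mult_ac)
  moreover have "{0..n-1} = {..<n}"
    using assms by auto
  ultimately show ?thesis
    using Complex.bij_betw_roots_unity[OF assms] by simp
qed

lemma prod_diff_roots_unity:
  fixes x :: complex
  assumes "n > 0"
  shows "(\<Prod>u | u ^ n = 1. x - u) = x ^ n - 1"
proof -
  define p :: "complex poly" where "p = monom 1 n - 1"
  have roots: "poly p u = 0 \<longleftrightarrow> u ^ n = 1" for u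
    by (simp add: p_def poly_monom)
  have "poly (pderiv p) u \<noteq> 0" if "poly p u = 0" for u
  proof -
    have "u \<noteq> 0"
      using that roots assms by (auto simp: power_0_left)
    then show ?thesis
      using assms by (simp add: p_def pderiv_diff pderiv_monom poly_monom)
  qed
  then have "rsquarefree p"
    by (auto simp: rsquarefree_roots)
  \<comment> \<open>All roots of \<open>p\<close> are simple, so \<open>p\<close> is the product of its distinct linear factors.\<close>
  then have "smult (lead_coeff p) (\<Prod>u | poly p u = 0. [:-u, 1:]) = p"
    by (rule complex_poly_decompose_rsquarefree)
  moreover have "degree p = n"
    using assms unfolding p_def
    by (subst diff_conv_add_uminus, subst degree_add_eq_left) (auto simp: degree_monom_eq)
  then have "lead_coeff p = 1"
    using assms by (simp add: p_def)
  ultimately have "poly (\<Prod>u | u ^ n = 1. [:-u, 1:]) x = poly p x"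
    by (simp add: roots)
  then show ?thesis
    by (simp add: poly_prod p_def poly_monom)
qed

lemma prod_one_minus_roots_unity:
  fixes y :: complex
  assumes "n > 0"
  shows "(\<Prod>u | u ^ n = 1. 1 - y * u) = 1 - y ^ n"
proof (cases "y = 0")
  case True
  with assms show ?thesis by simp
next
  case False
  then have "(\<Prod>u | u ^ n = 1. 1 - y * u) = (\<Prod>u::complex | u ^ n = 1. y * (1 / y - u))"
    by (intro prod.cong) (auto simp: field_simps)
  also have "\<dots> = y ^ n * ((1 / y) ^ n - 1)"
    using assms
    by (simp only: prod.distrib prod_constant card_roots_unity_eq prod_diff_roots_unity)
  also have "\<dots> = 1 - y ^ n"
    using False by (simp add: field_simps)
  finally show ?thesis .
qed

section \<open>The product of reciprocal gamma functions\<close>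

text \<open>
  The Weierstrass product of \<open>1 / \<Gamma>\<close> at \<open>- w\<close>, divided by its linear factor \<open>- w\<close> by means of
  the functional equation; the hypothesis \<open>w \<noteq> 0\<close> comes only from this division.
\<close>

lemma rGamma_one_minus_LIMSEQ:
  fixes w :: complex
  assumes "w \<noteq> 0"
  shows "(\<lambda>N. exp (- (euler_mascheroni * w)) * (\<Prod>k=1..N. (1 - w / of_nat k) * exp (w / of_nat k)))
           \<longlonglongrightarrow> rGamma (1 - w)"
proof -
  have "(\<lambda>N. rGamma_series_Weierstrass (- w) N / (- w)) \<longlonglongrightarrow> rGamma (- w) / (- w)"
    using assms by (intro tendsto_intros rGamma_Weierstrass_complex) auto
  moreover have "rGamma (- w) / (- w) = rGamma (1 - w)"
    using assms by (simp flip: rGamma_plus1[of "- w"])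
  moreover have "rGamma_series_Weierstrass (- w) N / (- w) =
      exp (- (euler_mascheroni * w)) * (\<Prod>k=1..N. (1 - w / of_nat k) * exp (w / of_nat k))" for N
    using assms by (simp add: rGamma_series_Weierstrass_def)
  ultimately show ?thesis by simp
qed

lemma rGamma_roots_prod_LIMSEQ:
  fixes z :: complex
  assumes "n > 1" "z \<noteq> 0"
  shows "(\<lambda>N. \<Prod>k=1..N. 1 - z ^ n / of_nat k ^ n)
           \<longlonglongrightarrow> (\<Prod>u | u ^ n = 1. rGamma (1 - z * u))"
proof -
  let ?R = "{u::complex. u ^ n = 1}"
  have fin: "finite ?R"
    using assms by (intro finite_roots_unity) auto
  have sum_scaled: "(\<Sum>u\<in>?R. c * u) = 0" for c :: complex
    using sum_roots_unity[OF assms(1)] by (simp flip: sum_distrib_left)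
  have "(\<lambda>N. \<Prod>u\<in>?R. exp (- (euler_mascheroni * (z * u))) *
          (\<Prod>k=1..N. (1 - z * u / of_nat k) * exp (z * u / of_nat k)))
        \<longlonglongrightarrow> (\<Prod>u\<in>?R. rGamma (1 - z * u))"
    using assms by (intro tendsto_prod rGamma_one_minus_LIMSEQ) (auto simp: power_0_left)
  moreover have "(\<Prod>u\<in>?R. exp (- (euler_mascheroni * (z * u))) *
          (\<Prod>k=1..N. (1 - z * u / of_nat k) * exp (z * u / of_nat k)))
      = (\<Prod>k=1..N. 1 - z ^ n / of_nat k ^ n)" for N
  proof -
    have "(\<Prod>u\<in>?R. exp (- (euler_mascheroni * (z * u)))) = 1"
      using sum_scaled[of "- (euler_mascheroni * z)"] fin
      by (simp add: mult.assoc flip: exp_sum)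
    moreover have "(\<Prod>u\<in>?R. (1 - z * u / of_nat k) * exp (z * u / of_nat k))
        = 1 - z ^ n / of_nat k ^ n" for k
    proof -
      have "(\<Prod>u\<in>?R. exp (z * u / of_nat k)) = 1"
        using sum_scaled[of "z / of_nat k"] fin by (simp flip: exp_sum)
      then show ?thesis
        using prod_one_minus_roots_unity[of n "z / of_nat k"] assms
        by (simp add: prod.distrib power_divide)
    qed
    ultimately show ?thesis
      by (subst prod.distrib, subst prod.swap) simp
  qed
  ultimately show ?thesis by simp
qed

section \<open>The zeta value and bounds for the product\<close>

lemma sums_riemann_zeta_of_nat:
  assumes "n > 1"
  obtains Z where "riemann_zeta (of_nat n) = of_real Z"
    and "(\<lambda>N. \<Sum>k=1..N. 1 / real k ^ n) \<longlonglongrightarrow> Z"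
proof
  let ?f = "\<lambda>k. 1 / real (Suc k) ^ n"
  have "summable (\<lambda>k. inverse (real k ^ n))"
    using assms by (intro inverse_power_summable) auto
  then have summ: "summable ?f"
    by (subst (asm) summable_Suc_iff[symmetric]) (simp add: divide_inverse)
  have "(1 / of_nat (Suc k) powr of_nat n :: complex) = of_real (?f k)" for k
    by (subst powr_nat') (use assms in auto)
  then show "riemann_zeta (of_nat n) = of_real (suminf ?f)"
    using assms suminf_of_real[OF summ, where 'a = complex]
    by (simp add: riemann_zeta_def zeta_series_def)
  have "(\<lambda>N. \<Sum>k<N. ?f k) \<longlonglongrightarrow> suminf ?f"
    by (rule summable_LIMSEQ[OF summ])
  moreover have "(\<Sum>k<N. ?f k) = (\<Sum>k=1..N. 1 / real k ^ n)" for N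
    by (rule sum.reindex_bij_witness[of _ "\<lambda>k. k - 1" Suc]) auto
  ultimately show "(\<lambda>N. \<Sum>k=1..N. 1 / real k ^ n) \<longlonglongrightarrow> suminf ?f"
    by simp
qed

lemma prod_one_minus_times_one_plus_sum_le_1:
  fixes a :: "'a \<Rightarrow> real"
  assumes "finite A" "\<And>k. k \<in> A \<Longrightarrow> 0 \<le> a k" "\<And>k. k \<in> A \<Longrightarrow> a k \<le> 1"
  shows "(\<Prod>k\<in>A. 1 - a k) * (1 + (\<Sum>k\<in>A. a k)) \<le> 1"
proof -
  have "(\<Prod>k\<in>A. 1 - a k) \<le> (\<Prod>k\<in>A. exp (- a k))"
    using assms exp_ge_add_one_self[of "- a k" for k] by (intro prod_mono) auto
  also have "\<dots> = exp (- (\<Sum>k\<in>A. a k))"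
    using assms by (simp add: exp_sum flip: sum_negf)
  finally have "(\<Prod>k\<in>A. 1 - a k) * (1 + (\<Sum>k\<in>A. a k))
      \<le> exp (- (\<Sum>k\<in>A. a k)) * exp (\<Sum>k\<in>A. a k)"
    using assms by (intro mult_mono) (auto intro!: add_nonneg_nonneg sum_nonneg)
  then show ?thesis
    by (simp flip: exp_add)
qed

text \<open>
  The product is real, being a limit of real partial products, although its factors need not be.
  Both bounds are obtained for the partial products and then passed to the limit.
\<close>

lemma rGamma_roots_prod_bounds:
  fixes z Z :: real
  assumes n: "n > 1" and z: "0 < z" "z \<le> 1"
    and Z: "(\<lambda>N. \<Sum>k=1..N. 1 / real k ^ n) \<longlonglongrightarrow> Z"
  obtains q where "(\<Prod>u | u ^ n = 1. rGamma (1 - of_real z * u)) = complex_of_real q"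
    and "1 - z ^ n * Z \<le> q" and "q * (1 + z ^ n * Z) \<le> 1"
proof -
  let ?P = "\<lambda>N. \<Prod>k=1..N. 1 - z ^ n / real k ^ n"
  let ?Q = "\<Prod>u | u ^ n = 1. rGamma (1 - of_real z * u) :: complex"
  have "(\<lambda>N. \<Prod>k=1..N. 1 - (of_real z :: complex) ^ n / of_nat k ^ n) \<longlonglongrightarrow> ?Q"
    using n z by (intro rGamma_roots_prod_LIMSEQ) auto
  then have lim: "(\<lambda>N. complex_of_real (?P N)) \<longlonglongrightarrow> ?Q"
    by simp
  then have "?Q \<in> \<real>"
    by (rule Lim_in_closed_set[OF closed_complex_Reals, rotated 2]) auto
  then obtain q where q: "?Q = of_real q"
    by (auto elim: Reals_cases)
  with lim have Pq: "?P \<longlonglongrightarrow> q"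
    by (simp only: tendsto_of_real_iff)
  have S: "(\<lambda>N. \<Sum>k=1..N. z ^ n / real k ^ n) \<longlonglongrightarrow> z ^ n * Z"
    using tendsto_mult_left[OF Z, of "z ^ n"] by (simp add: sum_distrib_left)
  have range: "0 \<le> z ^ n / real k ^ n" "z ^ n / real k ^ n \<le> 1" if "k \<in> {1..N}" for k N
  proof -
    have "z ^ n \<le> 1" "1 \<le> real k ^ n"
      using z that by (auto intro!: power_le_one one_le_power)
    then show "z ^ n / real k ^ n \<le> 1"
      by (simp add: divide_le_eq)
  qed (use z in auto)
  have "1 - z ^ n * Z \<le> q"
    using range
    by (intro tendsto_le[OF sequentially_bot Pq tendsto_diff[OF tendsto_const S]]
        always_eventually allI Weierstrass_prod_ineq) auto
  moreover have "q * (1 + z ^ n * Z) \<le> 1"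
    using range
    by (intro tendsto_upperbound[OF tendsto_mult[OF Pq tendsto_add[OF tendsto_const S]]]
        always_eventually allI prod_one_minus_times_one_plus_sum_le_1) auto
  ultimately show ?thesis
    using that q by blast
qed

section \<open>The limit\<close>

theorem corollary4:
  fixes n :: nat
  assumes "n > 1"
  shows "((\<lambda>z::real.
            ((\<Prod>j=0..n-1. Gamma (1 - of_real z * e (real j / real n)))
             - (\<Prod>j=0..n-1. inverse (Gamma (1 - of_real z * e (real j / real n)))))
            / (2 * of_real z ^ n))
          \<longlongrightarrow> riemann_zeta (of_nat n)) (at_right 0)"
proof -
  obtain Z where Z: "riemann_zeta (of_nat n) = of_real Z"
    and lim: "(\<lambda>N. \<Sum>k=1..N. 1 / real k ^ n) \<longlonglongrightarrow> Z"
    using sums_riemann_zeta_of_nat[OF assms] .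
  have Z_nonneg: "Z \<ge> 0"
    by (rule tendsto_lowerbound[OF lim]) (auto intro!: always_eventually sum_nonneg)
  define q where "q z = Re (\<Prod>u | u ^ n = 1. rGamma (1 - of_real z * u))" for z :: real
  have bounds: "(\<Prod>u | u ^ n = 1. rGamma (1 - of_real z * u)) = complex_of_real (q z)
      \<and> 1 - z ^ n * Z \<le> q z \<and> q z * (1 + z ^ n * Z) \<le> 1" if "0 < z" "z \<le> 1" for z
    using rGamma_roots_prod_bounds[OF assms that lim] unfolding q_def
    by (metis Re_complex_of_real)
  have ev: "\<forall>\<^sub>F z in at_right 0. 0 < z \<and> z \<le> (1::real)"
    using eventually_at_right_real[of 0 1] by (auto elim: eventually_mono)
  have pow: "((\<lambda>z. z ^ n) \<longlongrightarrow> 0) (at_right (0::real))"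
    using tendsto_power[OF tendsto_ident_at[of "0::real" "{0<..}"], of n] assms by (simp add: power_0_left)
  have slope: "((\<lambda>z. (1 - q z) / z ^ n) \<longlongrightarrow> Z) (at_right 0)"
  proof (rule tendsto_sandwich)
    have "((\<lambda>z. Z / (1 + z ^ n * Z)) \<longlongrightarrow> Z / (1 + 0 * Z)) (at_right 0)"
      by (intro tendsto_intros pow) auto
    then show "((\<lambda>z. Z / (1 + z ^ n * Z)) \<longlongrightarrow> Z) (at_right 0)"
      by simp
    show "\<forall>\<^sub>F z in at_right 0. Z / (1 + z ^ n * Z) \<le> (1 - q z) / z ^ n"
      using ev
    proof eventually_elim
      case (elim z)
      then have "z ^ n > 0" "1 + z ^ n * Z > 0"
        using Z_nonneg by (auto intro!: add_pos_nonneg)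
      then show ?case
        using bounds[of z] elim by (simp add: divide_simps) (simp add: algebra_simps)
    qed
    show "\<forall>\<^sub>F z in at_right 0. (1 - q z) / z ^ n \<le> Z"
      using ev
    proof eventually_elim
      case (elim z)
      then show ?case
        using bounds[of z] by (simp add: divide_simps mult.commute)
    qed
  qed simp
  have "((\<lambda>z. 1 - z ^ n * ((1 - q z) / z ^ n)) \<longlongrightarrow> 1 - 0 * Z) (at_right 0)"
    by (intro tendsto_intros pow slope)
  moreover have "\<forall>\<^sub>F z in at_right 0. 1 - z ^ n * ((1 - q z) / z ^ n) = q z"
    using ev by (rule eventually_mono) simp
  ultimately have q1: "(q \<longlongrightarrow> 1) (at_right 0)"
    using Lim_transform_eventually by fastforce
  have "((\<lambda>z. (1 - q z) / z ^ n * ((1 + q z) / (2 * q z))) \<longlongrightarrow> Z * ((1 + 1) / (2 * 1))) (at_right 0)"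
    by (intro tendsto_intros slope q1) auto
  then have "((\<lambda>z. complex_of_real ((1 - q z) / z ^ n * ((1 + q z) / (2 * q z))))
      \<longlongrightarrow> riemann_zeta (of_nat n)) (at_right 0)"
    unfolding Z by (intro tendsto_of_real) simp
  moreover have "\<forall>\<^sub>F z in at_right 0. q z > 0"
    using order_tendstoD(1)[OF q1] by simp
  then have "\<forall>\<^sub>F z in at_right 0.
      complex_of_real ((1 - q z) / z ^ n * ((1 + q z) / (2 * q z))) =
      ((\<Prod>j=0..n-1. Gamma (1 - of_real z * e (real j / real n)))
        - (\<Prod>j=0..n-1. inverse (Gamma (1 - of_real z * e (real j / real n)))))
      / (2 * of_real z ^ n)"
    using ev
  proof eventually_elim
    case (elim z)
    have "(\<Prod>j=0..n-1. inverse (Gamma (1 - of_real z * e (real j / real n))))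
        = (\<Prod>u | u ^ n = 1. rGamma (1 - of_real z * u))"
      using prod.reindex_bij_betw[OF bij_betw_e_roots_unity[of n],
          of "\<lambda>u. rGamma (1 - of_real z * u)"] assms
      by (simp add: Gamma_def)
    also have "\<dots> = of_real (q z)"
      using bounds elim by blast
    finally have Q: "(\<Prod>j=0..n-1. inverse (Gamma (1 - of_real z * e (real j / real n))))
        = of_real (q z)" .
    then have "(\<Prod>j=0..n-1. Gamma (1 - of_real z * e (real j / real n))) = inverse (of_real (q z))"
      by (metis (no_types, lifting) inverse_inverse_eq prod_inversef comp_def prod.cong)
    moreover have "(1 - q z) / z ^ n * ((1 + q z) / (2 * q z)) = (inverse (q z) - q z) / (2 * z ^ n)"
      using elim by (simp add: field_simps)
    ultimately show ?case
      unfolding Q by simp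
  qed
  ultimately show ?thesis
    by (rule Lim_transform_eventually)
qed

end
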